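(* Let $\tau=213$. For all $k\ge 2$, \[ F_\tau(x,y;k)=\frac{1}{1-x-x\sum_{i=0}^{k-2}\prod_{j=0}^{i}\bigl(1-jx^2(1-y)\bigr)}. \]
   Context: $[k]^n$ is the set of words of length $n$ over $\{1,\dots,k\}$. An occurrence of the subword pattern $213$ in $\sigma=\sigma_1\cdots\sigma_n$ is an index $i$ with $\sigma_{i+1}<\sigma_i<\sigma_{i+2}$. $\sigma(213)$ is the number of occurrences, and $F_{213}(x,y;k)=\sum_{n\ge0}\sum_{\sigma\in[k]^n}x^ny^{\sigma(213)}$. *)

theory Defs
  imports "HOL-Computational_Algebra.Formal_Power_Series"
begin

definition words :: "nat \<Rightarrow> nat \<Rightarrow> nat list set" where
  "words k n = {w. length w = n \<and> set w \<subseteq> {1..k}}"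

text \<open>List positions are 0-based, so the entries compared are those at \<open>i\<close>, \<open>i + 1\<close>, \<open>i + 2\<close>
  with \<open>i + 2 < length w\<close>.\<close>

definition occ213 :: "nat list \<Rightarrow> nat" where
  "occ213 w = card {i. i + 2 < length w \<and> w ! (i + 1) < w ! i \<and> w ! i < w ! (i + 2)}"

text \<open>Both \<open>x\<close> and \<open>y\<close> are indeterminates: the type \<^typ>\<open>rat fps fps\<close> is the ring
  of formal power series in \<open>x\<close> whose coefficients are formal power series in \<open>y\<close>.\<close>

abbreviation var_x :: "rat fps fps" where
  "var_x \<equiv> fps_X"

abbreviation var_y :: "rat fps fps" where
  "var_y \<equiv> fps_const fps_X"

definition F213 :: "nat \<Rightarrow> rat fps fps" where
  "F213 k = Abs_fps (\<lambda>n. \<Sum>w\<in>words k n. fps_X ^ occ213 w)"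

text \<open>The coefficient ring is not a field, but a series with constant term 1 is a unit, and the
  library division then yields its true inverse.\<close>

lemma fps_fps_mult_one_divide:
  fixes d :: "rat fps fps"
  assumes "fps_nth d 0 = 1"
  shows "d * (1 / d) = 1"
proof -
  have sd: "subdegree d = 0"
    using assms by (intro subdegreeI) auto
  have "1 / d = inverse d"
    by (simp add: fps_divide_def sd)
  also have "\<dots> = fps_right_inverse d 1"
    using assms by (simp add: fps_inverse_def[of d])
  finally show ?thesis
    using assms by (simp add: fps_right_inverse)
qed

end

theory Submission
  imports Defs
begin

text \<open>
  Let \<open>G\<^sub>c\<close> count the words that start with the letter \<open>c\<close>, and put \<open>z = x\<^sup>2 (1 - y)\<close>.
  Prepending \<open>c\<close> to a word \<open>w\<close> creates a new occurrence iff \<open>w\<close> starts with \<open>b d\<close> where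
  \<open>b < c < d\<close>, and prepending such a \<open>b\<close> to a word starting with \<open>d > b\<close> never creates one.
  Hence \<open>G\<^sub>c = x F - (c - 1) z \<Sum>\<^bsub>d > c\<^esub> G\<^sub>d\<close>. For the tail sums \<open>S\<^sub>c = \<Sum>\<^bsub>d \<ge> c\<^esub> G\<^sub>d\<close> this reads
  \<open>S\<^sub>c = x F + (1 - (c - 1) z) S\<^bsub>c + 1\<^esub>\<close>, which unfolds to a sum of products, and \<open>F = 1 + S\<^sub>1\<close>.
\<close>

lemma occ213_Nil [simp]: "occ213 [] = 0"
  by (simp add: occ213_def)

text \<open>Only position 0 of \<open>a # w\<close> is new. Every occurrence in \<open>w\<close>
  reappears with its index shifted by \<open>Suc\<close>.\<close>

lemma occ213_Cons:
  "occ213 (a # w) = occ213 w + (if 1 < length w \<and> w ! 0 < a \<and> a < w ! 1 then 1 else 0)"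
proof -
  let ?P = "\<lambda>w i. i + 2 < length w \<and> w ! (i + 1) < w ! i \<and> w ! i < w ! (i + 2)"
  have "{i. ?P (a # w) i} = (if ?P (a # w) 0 then {0} else {}) \<union> Suc ` {i. ?P w i}" (is "?L = ?R")
  proof (rule set_eqI)
    fix i
    show "i \<in> ?L \<longleftrightarrow> i \<in> ?R"
      by (cases i) auto
  qed
  moreover have "finite {i. ?P w i}"
    by (rule finite_subset[of _ "{..<length w}"]) auto
  moreover have "?P (a # w) 0 \<longleftrightarrow> 1 < length w \<and> w ! 0 < a \<and> a < w ! 1"
    by simp
  ultimately show ?thesis
    unfolding occ213_def by (subst (1) \<open>?L = ?R\<close>) (auto simp: card_image)
qed

lemma finite_words [simp]: "finite (words k n)"
  unfolding words_def
  by (rule finite_subset[OF _ finite_lists_length_eq[of "{1..k}" n]]) auto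

text \<open>The set \<open>A\<close> may mix lengths and be infinite: the coefficient of each power
  of x meets it with the finite set \<open>words k n\<close>. Splitting a language thus becomes
  addition of series.\<close>

definition words_gf :: "nat \<Rightarrow> nat list set \<Rightarrow> rat fps fps" where
  "words_gf k A = Abs_fps (\<lambda>n. \<Sum>w\<in>words k n \<inter> A. fps_X ^ occ213 w)"

lemma F213_eq_words_gf: "F213 k = words_gf k (lists {1..k})"
proof -
  have "words k n \<inter> lists {1..k} = words k n" for n
    by (auto simp: words_def)
  then show ?thesis
    by (simp add: F213_def words_gf_def)
qed

lemma words_gf_UNION:
  assumes "finite I" "\<And>i j. i \<in> I \<Longrightarrow> j \<in> I \<Longrightarrow> i \<noteq> j \<Longrightarrow> A i \<inter> A j = {}"
  shows "words_gf k (\<Union>i\<in>I. A i) = (\<Sum>i\<in>I. words_gf k (A i))"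
proof (rule fps_ext)
  fix n
  have "(\<Sum>w\<in>(\<Union>i\<in>I. words k n \<inter> A i). fps_X ^ occ213 w :: rat fps)
      = (\<Sum>i\<in>I. \<Sum>w\<in>words k n \<inter> A i. fps_X ^ occ213 w)"
    using assms(1) assms(2)[THEN equalityD1]
    by (intro sum.UNION_disjoint ballI impI finite_Int) (simp_all, blast)
  then show "fps_nth (words_gf k (\<Union>i\<in>I. A i)) n = fps_nth (\<Sum>i\<in>I. words_gf k (A i)) n"
    by (simp add: words_gf_def fps_sum_nth)
qed

lemma words_gf_Un:
  assumes "A \<inter> B = {}"
  shows "words_gf k (A \<union> B) = words_gf k A + words_gf k B"
proof (rule fps_ext)
  fix n
  show "fps_nth (words_gf k (A \<union> B)) n = fps_nth (words_gf k A + words_gf k B) n"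
    using assms by (simp add: words_gf_def Int_Un_distrib, intro sum.union_disjoint) auto
qed

lemma words_gf_Nil: "words_gf k {[]} = 1"
proof (rule fps_ext)
  fix n
  have "words k n \<inter> {[]} = (if n = 0 then {[]} else {})"
    by (auto simp: words_def)
  then show "fps_nth (words_gf k {[]}) n = fps_nth 1 n"
    by (simp add: words_gf_def)
qed

text \<open>The added letter costs one factor x, and the same number \<open>m\<close> of new
  occurrences in every word of \<open>A\<close> lets \<open>var_y ^ m\<close> be pulled out of the
  sum.\<close>

lemma words_gf_Cons:
  assumes "c \<in> {1..k}" "\<And>w. w \<in> A \<Longrightarrow> occ213 (c # w) = occ213 w + m"
  shows "words_gf k ((#) c ` A) = var_x * var_y ^ m * words_gf k A"
proof (rule fps_ext)
  fix n
  show "fps_nth (words_gf k ((#) c ` A)) n = fps_nth (var_x * var_y ^ m * words_gf k A) n"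
  proof (cases n)
    case 0
    have "words k 0 \<inter> (#) c ` A = {}"
      by (auto simp: words_def)
    then show ?thesis
      by (simp add: words_gf_def 0 mult.assoc)
  next
    case (Suc n')
    have "words k n \<inter> (#) c ` A = (#) c ` (words k n' \<inter> A)"
      using assms(1) by (auto simp: words_def Suc)
    then have "fps_nth (words_gf k ((#) c ` A)) n = (\<Sum>w\<in>words k n' \<inter> A. fps_X ^ occ213 (c # w))"
      by (simp add: words_gf_def sum.reindex)
    also have "\<dots> = (\<Sum>w\<in>words k n' \<inter> A. fps_X ^ m * fps_X ^ occ213 w)"
      by (intro sum.cong) (auto simp: assms(2) power_add mult.commute)
    also have "\<dots> = fps_nth (var_x * var_y ^ m * words_gf k A) n"
      by (simp add: words_gf_def Suc mult.assoc sum_distrib_left fps_const_power)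
    finally show ?thesis .
  qed
qed

abbreviation first_gf :: "nat \<Rightarrow> nat \<Rightarrow> rat fps fps" where
  "first_gf k c \<equiv> words_gf k ((#) c ` lists {1..k})"

lemma F213_first_letter: "F213 k = 1 + (\<Sum>c\<in>{1..k}. first_gf k c)"
proof -
  have "lists {1..k} = {[]} \<union> (\<Union>c\<in>{1..k}. (#) c ` lists {1..k})" (is "?L = ?R")
  proof (rule set_eqI)
    fix w
    show "w \<in> ?L \<longleftrightarrow> w \<in> ?R"
      by (cases w) auto
  qed
  then have "F213 k = words_gf k ?R"
    by (simp only: F213_eq_words_gf)
  also have "\<dots> = words_gf k {[]} + words_gf k (\<Union>c\<in>{1..k}. (#) c ` lists {1..k})"
    by (rule words_gf_Un) auto
  also have "words_gf k (\<Union>c\<in>{1..k}. (#) c ` lists {1..k}) = (\<Sum>c\<in>{1..k}. first_gf k c)"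
    by (rule words_gf_UNION) auto
  finally show ?thesis
    by (simp add: words_gf_Nil)
qed

lemma first_gf_rec:
  assumes c: "c \<in> {1..k}"
  shows "first_gf k c = var_x * F213 k
    - of_nat (c - 1) * var_x ^ 2 * (1 - var_y) * (\<Sum>d\<in>{c<..k}. first_gf k d)"
proof -
  let ?L = "lists {1..k}"
  \<comment> \<open>\<open>D\<close> collects the words over \<open>{1..k}\<close> before which the
    letter \<open>c\<close> creates an occurrence.\<close>
  define D where "D = (\<Union>b\<in>{1..<c}. \<Union>d\<in>{c<..k}. (#) b ` (#) d ` ?L)"
  have D_iff: "w \<in> D \<longleftrightarrow> w \<in> ?L \<and> 1 < length w \<and> w ! 0 < c \<and> c < w ! 1" for w
  proof (cases w)
    case (Cons b v)
    then show ?thesis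
      using c by (cases v) (auto simp: D_def image_image image_iff)
  qed (auto simp: D_def)
  have pair: "words_gf k ((#) b ` (#) d ` ?L) = var_x * first_gf k d"
    if "b \<in> {1..<c}" "d \<in> {c<..k}" for b d
  proof -
    \<comment> \<open>Since \<open>b < c < d\<close>, the letter \<open>b\<close> is followed by a
      larger one and starts no occurrence.\<close>
    have "words_gf k ((#) b ` (#) d ` ?L) = var_x * var_y ^ 0 * first_gf k d"
      using that c by (intro words_gf_Cons) (auto simp: occ213_Cons[of b])
    then show ?thesis
      by simp
  qed
  have gf_D: "words_gf k D = of_nat (c - 1) * var_x * (\<Sum>d\<in>{c<..k}. first_gf k d)"
  proof -
    have "words_gf k D = (\<Sum>b\<in>{1..<c}. words_gf k (\<Union>d\<in>{c<..k}. (#) b ` (#) d ` ?L))"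
      unfolding D_def by (rule words_gf_UNION) auto
    also have "\<dots> = (\<Sum>b\<in>{1..<c}. \<Sum>d\<in>{c<..k}. words_gf k ((#) b ` (#) d ` ?L))"
      by (intro sum.cong refl words_gf_UNION) auto
    also have "\<dots> = (\<Sum>b\<in>{1..<c}. \<Sum>d\<in>{c<..k}. var_x * first_gf k d)"
      by (intro sum.cong refl pair)
    \<comment> \<open>The summand no longer depends on \<open>b\<close>, which has
      \<open>c - 1\<close> possible values.\<close>
    finally show ?thesis
      by (simp add: sum_distrib_left mult.assoc)
  qed
  have split_L: "?L = (?L - D) \<union> D"
    using D_iff by blast
  have "F213 k = words_gf k ((?L - D) \<union> D)"
    using split_L by (simp only: F213_eq_words_gf)
  also have "\<dots> = words_gf k (?L - D) + words_gf k D"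
    by (rule words_gf_Un) auto
  finally have F: "words_gf k (?L - D) = F213 k - words_gf k D"
    by simp
  \<comment> \<open>Only the words in \<open>D\<close> gain a factor y, so the correction to x F is
    -x (1 - y) times the series of \<open>D\<close>.\<close>
  have "first_gf k c = words_gf k ((#) c ` (?L - D) \<union> (#) c ` D)"
    using split_L by (simp only: image_Un[symmetric])
  also have "\<dots> = words_gf k ((#) c ` (?L - D)) + words_gf k ((#) c ` D)"
    by (rule words_gf_Un) auto
  also have "words_gf k ((#) c ` (?L - D)) = var_x * var_y ^ 0 * words_gf k (?L - D)"
    using c by (intro words_gf_Cons) (auto simp: occ213_Cons D_iff)
  also have "words_gf k ((#) c ` D) = var_x * var_y ^ 1 * words_gf k D"
    using c by (intro words_gf_Cons) (auto simp: occ213_Cons D_iff)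
  finally show ?thesis
    unfolding F gf_D by (simp add: algebra_simps power2_eq_square)
qed

text \<open>Downward induction from the empty tail \<open>m = k\<close>. The tail starts at the
  letter \<open>m + 1\<close>, so the factor contributed by that letter has
  \<open>j = m\<close>.\<close>

lemma tail_sum_first_gf:
  assumes "m \<le> k"
  shows "(\<Sum>d\<in>{m<..k}. first_gf k d) = var_x * F213 k *
    (\<Sum>i\<in>{m..<k}. \<Prod>j\<in>{m..<i}. (1 - of_nat j * var_x ^ 2 * (1 - var_y)))"
  using assms
proof (induction m rule: inc_induct)
  case base
  show ?case by simp
next
  case (step m)
  let ?p = "\<lambda>j. 1 - of_nat j * var_x ^ 2 * (1 - var_y)"
  have "{m<..k} = insert (Suc m) {Suc m<..k}"
    using step.hyps by auto
  then have "(\<Sum>d\<in>{m<..k}. first_gf k d)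
      = first_gf k (Suc m) + (\<Sum>d\<in>{Suc m<..k}. first_gf k d)"
    by simp
  also have "\<dots> = var_x * F213 k + ?p m * (\<Sum>d\<in>{Suc m<..k}. first_gf k d)"
    using first_gf_rec[of "Suc m" k] step.hyps by (simp add: algebra_simps)
  also have "\<dots> = var_x * F213 k *
      (1 + (\<Sum>i\<in>{Suc m..<k}. ?p m * (\<Prod>j\<in>{Suc m..<i}. ?p j)))"
    unfolding step.IH sum_distrib_left[symmetric] by (simp only: distrib_left mult_1_left mult_1_right mult_ac)
  also have "(\<Sum>i\<in>{Suc m..<k}. ?p m * (\<Prod>j\<in>{Suc m..<i}. ?p j))
      = (\<Sum>i\<in>{Suc m..<k}. \<Prod>j\<in>{m..<i}. ?p j)"
    by (intro sum.cong refl) (simp add: prod.atLeast_Suc_lessThan[of m])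
  \<comment> \<open>The summand 1 is the empty product at \<open>i = m\<close>.\<close>
  also have "1 + \<dots> = (\<Sum>i\<in>{m..<k}. \<Prod>j\<in>{m..<i}. ?p j)"
    using step.hyps by (simp add: sum.atLeast_Suc_lessThan[of m])
  finally show ?case .
qed

theorem theorem3p4:
  fixes k :: nat
  assumes "k \<ge> 2"
  shows "F213 k = 1 / (1 - var_x - var_x *
    (\<Sum>i=0..k-2. \<Prod>j=0..i. (1 - of_nat j * var_x ^ 2 * (1 - var_y))))"
proof -
  let ?p = "\<lambda>j. 1 - of_nat j * var_x ^ 2 * (1 - var_y)"
  let ?S = "\<Sum>i=0..k-2. \<Prod>j=0..i. ?p j"
  let ?d = "1 - var_x - var_x * ?S"
  \<comment> \<open>The empty product at \<open>i = 0\<close> yields the separate term -x of the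
    denominator; shifting the other indices by one gives closed ranges.\<close>
  have "(\<Sum>i\<in>{0..<k}. \<Prod>j\<in>{0..<i}. ?p j) = 1 + (\<Sum>i\<in>{Suc 0..<k}. \<Prod>j\<in>{0..<i}. ?p j)"
    using assms by (simp add: sum.atLeast_Suc_lessThan[of 0])
  also have "{Suc 0..<k} = {Suc 0..Suc (k - 2)}"
    using assms by auto
  also have "(\<Sum>i\<in>\<dots>. \<Prod>j\<in>{0..<i}. ?p j) = ?S"
    by (simp only: sum.shift_bounds_cl_Suc_ivl atLeastLessThanSuc_atLeastAtMost)
  finally have "(\<Sum>i\<in>{0..<k}. \<Prod>j\<in>{0..<i}. ?p j) = 1 + ?S" .
  moreover have "{1..k} = {0<..k}"
    by auto
  ultimately have "F213 k = 1 + var_x * F213 k * (1 + ?S)"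
    using F213_first_letter[of k] tail_sum_first_gf[of 0 k] by simp
  then have F_d: "F213 k * ?d = 1"
    by (simp add: algebra_simps)
  \<comment> \<open>All terms of \<open>?d\<close> except 1 carry a factor x, so its constant term
    is 1 and it is a unit.\<close>
  have d_inv: "?d * (1 / ?d) = 1"
    by (rule fps_fps_mult_one_divide) simp
  have "F213 k = F213 k * (?d * (1 / ?d))"
    by (simp only: d_inv mult_1_right)
  also have "\<dots> = 1 / ?d"
    by (simp only: mult.assoc[symmetric] F_d mult_1_left)
  finally show ?thesis .
qed

end
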